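(* Let $A\in\mathbb{R}^{n\times n}$ be symmetric positive definite, $\bm b\in\mathbb{R}^n$, $f(\bm x)=\frac12\bm x^TA\bm x-\bm b^T\bm x$, and let $L>0$, $\ell\ge0$ be such that $f$ is $L$-smooth and $\ell$-strongly convex. Then, in exact arithmetic, the C+AG algorithm (defined in the context) run on $f$ from any $\bm x_0\in\mathbb{R}^n$ with these values of $L,\ell$ is identical to linear conjugate gradient: its iterates coincide with the linear conjugate gradient iterates for $f$ started at $\bm x_0$, and hence it terminates finitely with the minimizer of $f$.
   Context: All norms are Euclidean. A differentiable $f$ is $L$-smooth and convex if $0\le f(\bm y)-f(\bm x)-\nabla f(\bm x)^T(\bm y-\bm x)\le \frac L2\|\bm x-\bm y\|^2$ for all $\bm x,\bm y$, and $\ell$-strongly convex if $f(\bm y)-f(\bm x)-\nabla f(\bm x)^T(\bm y-\bm x)\ge\frac{\ell}{2}\|\bm x-\bm y\|^2$ for all $\bm x,\bm y$. Linear conjugate gradient for the quadratic $f$: $\bm p_0=-\nabla f(\bm x_0)$; for $k\ge0$, as long as $\nabla f(\bm x_k)\ne\bm 0$, $\alpha_k=-\nabla f(\bm x_k)^T\bm p_k/(\bm p_k^TA\bm p_k)$, $\bm x_{k+1}=\bm x_k+\alpha_k\bm p_k$, $\bm p_{k+1}=-\nabla f(\bm x_{k+1})+\beta_{k+1}\bm p_k$ with $\beta_{k+1}=\|\nabla f(\bm x_{k+1})\|^2/\|\nabla f(\bm x_k)\|^2$; stop once $\nabla f(\bm x_k)=\bm 0$. C+AG algorithm (known $L,\ell$;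 gradient tolerance $0$, i.e. it returns a point as soon as it evaluates a zero gradient there; a returned point counts as the final iterate). Write $\bm g_k=\nabla f(\bm x_k)$. Initialize $\bm v_0=\bm x_0$, $\phi_0^*=f(\bm x_0)$, $\gamma_0=L$, $\bm p_0=-\bm g_0$, flag onlyAG = false, counters $i_{cg}=i_{ag}=0$. For $k=0,1,2,\ldots$: let $\theta_k$ be the positive root of $L\theta^2+(\gamma_k-\ell)\theta-\gamma_k=0$ and $\gamma_{k+1}=(1-\theta_k)\gamma_k+\theta_k\ell$. For a point $\bar{\bm x}$ define the update $U_k(\bar{\bm x})=(\bm v_{k+1},\phi_{k+1}^* )$ by $$\bm v_{k+1}=\tfrac1{\gamma_{k+1}}\left[(1-\theta_k)\gamma_k\bm v_k+\theta_k\ell\bar{\bm x}-\theta_k\nabla f(\bar{\bm x})\right],$$ $$\phi_{k+1}^*=(1-\theta_k)\phi_k^*+\theta_kf(\bar{\bm x})-\tfrac{\theta_k^2}{2\gamma_{k+1}}\|\nabla f(\bar{\bm x})\|^2+\tfrac{\theta_k(1-\theta_k)\gamma_k}{\gamma_{k+1}}\left(\tfrac{\ell}{2}\|\bar{\bm x}-\bm v_k\|^2+\nabla f(\bar{\bm x})^T(\bm v_k-\bar{\bm x})\right).$$ Try the following step types in order until one is accepted (types 1 and 2 are skipped if onlyAG is true). Types 1 (conjugate gradient) and 2 (steepest descent restart): if the type is 2, or if $i_{cg}\ge 6n+1$, reset $\bm p_k=-\bm g_k$ and $i_{cg}=0$. Increase $i_{cg}$ by 1 and set $i_{ag}=0$.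 Evaluate $f,\nabla f$ at $\tilde{\bm x}=\bm x_k+\bm p_k/L$; let $\bm s=L(\nabla f(\tilde{\bm x})-\bm g_k)$. If $\bm g_k^T\bm p_k\ge0$ or $\bm p_k^T\bm s\le0$, the step type fails. Otherwise set $\alpha_k=-\bm g_k^T\bm p_k/(\bm p_k^T\bm s)$, $\bm x_{k+1}=\bm x_k+\alpha_k\bm p_k$, evaluate $f,\nabla f$ at $\bm x_{k+1}$, and set $(\bm v_{k+1},\phi_{k+1}^* )=U_k(\bm x_k)$. The step is accepted if and only if $f(\bm x_{k+1})\le\phi_{k+1}^*$; in that case put $\hat{\bm y}=\bm g_{k+1}-\bm g_k$, $\beta^1=\left(\hat{\bm y}-\bm p_k\frac{2\|\hat{\bm y}\|^2}{\hat{\bm y}^T\bm p_k}\right)^T\frac{\bm g_{k+1}}{\hat{\bm y}^T\bm p_k}$, $\beta^2=\frac{-1}{\|\bm p_k\|\min(0.01\|\bm g_0\|,\|\bm g_{k+1}\|)}$, $\beta_{k+1}=\max(\beta^1,\beta^2)$, $\bm p_{k+1}=-\bm g_{k+1}+\beta_{k+1}\bm p_k$, and go to the next $k$. Type 3 (accelerated gradient; always accepted): if onlyAG is false, set it to true and $i_{ag}=i_{cg}=0$. Increase $i_{ag}$ by 1. Let $\bar{\bm x}_k=\frac{\theta_k\gamma_k\bm v_k+\gamma_{k+1}\bm x_k}{\gamma_k+\theta_k\ell}$, evaluate $f,\nabla f$ at $\bar{\bm x}_k$, set $\bm x_{k+1}=\bar{\bm x}_k-\nabla f(\bar{\bm x}_k)/L$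 and $(\bm v_{k+1},\phi_{k+1}^* )=U_k(\bar{\bm x}_k)$. If $i_{ag}$ is divisible by 8, also evaluate $f,\nabla f$ at $\bm x_{k+1}$, and if $f(\bm x_{k+1})\le f(\bar{\bm x}_k)-\frac45\cdot\frac{\nabla f(\bar{\bm x}_k)^T(\nabla f(\bar{\bm x}_k)+\bm g_{k+1})}{2L}$, set $\bm p_{k+1}=-\bm g_{k+1}$ and onlyAG = false. *)

theory Defs
  imports "HOL-Analysis.Analysis"
begin

section \<open>Smooth, strongly convex and quadratic functions\<close>

definition grad :: "('a::real_inner \<Rightarrow> real) \<Rightarrow> 'a \<Rightarrow> 'a" where
  "grad f x = (THE d. GDERIV f x :> d)"

definition smooth_convex :: "real \<Rightarrow> ('a::real_inner \<Rightarrow> real) \<Rightarrow> bool" where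
  "smooth_convex L f \<longleftrightarrow>
     (\<forall>x. f differentiable (at x)) \<and>
     (\<forall>x y. 0 \<le> f y - f x - grad f x \<bullet> (y - x) \<and>
            f y - f x - grad f x \<bullet> (y - x) \<le> L / 2 * (norm (x - y))\<^sup>2)"

definition strongly_convex :: "real \<Rightarrow> ('a::real_inner \<Rightarrow> real) \<Rightarrow> bool" where
  "strongly_convex l f \<longleftrightarrow>
     (\<forall>x. f differentiable (at x)) \<and>
     (\<forall>x y. f y - f x - grad f x \<bullet> (y - x) \<ge> l / 2 * (norm (x - y))\<^sup>2)"

definition sym_pos_def :: "real^'n^'n \<Rightarrow> bool" where
  "sym_pos_def A \<longleftrightarrow> transpose A = A \<and> (\<forall>x. x \<noteq> 0 \<longrightarrow> 0 < x \<bullet> (A *v x))"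

definition quad :: "real^'n^'n \<Rightarrow> real^'n \<Rightarrow> real^'n \<Rightarrow> real" where
  "quad A b x = 1 / 2 * (x \<bullet> (A *v x)) - b \<bullet> x"


section \<open>Linear conjugate gradient\<close>

definition cg_step ::
  "real^'n^'n \<Rightarrow> real^'n \<Rightarrow> (real^'n) \<times> (real^'n) \<Rightarrow> (real^'n) \<times> (real^'n)" where
  "cg_step A b xp =
    (let (x, p) = xp;
         g = grad (quad A b) x;
         \<alpha> = - (g \<bullet> p) / (p \<bullet> (A *v p));
         x1 = x + \<alpha> *\<^sub>R p;
         g1 = grad (quad A b) x1;
         \<beta> = (norm g1)\<^sup>2 / (norm g)\<^sup>2
     in (x1, - g1 + \<beta> *\<^sub>R p))"

text \<open>The value is \<^term>\<open>None\<close> at all indices after the one at which the gradient vanishes.\<close>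

primrec cg_run ::
  "real^'n^'n \<Rightarrow> real^'n \<Rightarrow> real^'n \<Rightarrow> nat \<Rightarrow> ((real^'n) \<times> (real^'n)) option" where
  "cg_run A b x0 0 = Some (x0, - grad (quad A b) x0)"
| "cg_run A b x0 (Suc k) =
    (case cg_run A b x0 k of
       None \<Rightarrow> None
     | Some (x, p) \<Rightarrow> if grad (quad A b) x = 0 then None else Some (cg_step A b (x, p)))"

definition cg_iterate :: "real^'n^'n \<Rightarrow> real^'n \<Rightarrow> real^'n \<Rightarrow> nat \<Rightarrow> (real^'n) option" where
  "cg_iterate A b x0 k = map_option fst (cg_run A b x0 k)"


section \<open>The C+AG algorithm\<close>

record 'a cag_state =
  xk :: 'a
  vk :: 'a
  phik :: real
  gammak :: real
  pk :: 'a
  onlyAG :: bool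
  icg :: nat
  iag :: nat

datatype 'a outcome = Returned 'a | Running "'a cag_state"

text \<open>A failed step type hands its state on, since its changes to the search direction and to
  the counters remain in force for the step types tried after it.\<close>

datatype 'a attempt = Done "'a outcome" | Failed "'a cag_state"

definition theta :: "real \<Rightarrow> real \<Rightarrow> real \<Rightarrow> real" where
  "theta L l \<gamma> = (THE \<theta>. \<theta> > 0 \<and> L * \<theta>\<^sup>2 + (\<gamma> - l) * \<theta> - \<gamma> = 0)"

definition gamma_next :: "real \<Rightarrow> real \<Rightarrow> real \<Rightarrow> real" where
  "gamma_next L l \<gamma> = (1 - theta L l \<gamma>) * \<gamma> + theta L l \<gamma> * l"

definition v_next ::
  "('a::real_inner \<Rightarrow> real) \<Rightarrow> real \<Rightarrow> real \<Rightarrow> 'a cag_state \<Rightarrow> 'a \<Rightarrow> 'a" where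
  "v_next f L l s xbar =
    (let \<gamma> = gammak s; \<theta> = theta L l \<gamma>; \<gamma>1 = gamma_next L l \<gamma>
     in (1 / \<gamma>1) *\<^sub>R
          (((1 - \<theta>) * \<gamma>) *\<^sub>R vk s + (\<theta> * l) *\<^sub>R xbar - \<theta> *\<^sub>R grad f xbar))"

definition phi_next ::
  "('a::real_inner \<Rightarrow> real) \<Rightarrow> real \<Rightarrow> real \<Rightarrow> 'a cag_state \<Rightarrow> 'a \<Rightarrow> real" where
  "phi_next f L l s xbar =
    (let \<gamma> = gammak s; \<theta> = theta L l \<gamma>; \<gamma>1 = gamma_next L l \<gamma>
     in (1 - \<theta>) * phik s + \<theta> * f xbar - \<theta>\<^sup>2 / (2 * \<gamma>1) * (norm (grad f xbar))\<^sup>2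
        + \<theta> * (1 - \<theta>) * \<gamma> / \<gamma>1 *
          (l / 2 * (norm (xbar - vk s))\<^sup>2 + grad f xbar \<bullet> (vk s - xbar)))"

text \<open>The parameters \<open>g0\<close>, \<open>g\<close>, \<open>g1\<close> are the gradients at the starting point and at the
  current and next iterate, and \<open>p\<close> is the current search direction.\<close>

definition beta_next :: "'a::real_inner \<Rightarrow> 'a \<Rightarrow> 'a \<Rightarrow> 'a \<Rightarrow> real" where
  "beta_next g0 g g1 p =
    (let y = g1 - g;
         \<beta>1 = (y - (2 * (norm y)\<^sup>2 / (y \<bullet> p)) *\<^sub>R p) \<bullet> ((1 / (y \<bullet> p)) *\<^sub>R g1);
         \<beta>2 = - 1 / (norm p * min (1 / 100 * norm g0) (norm g1))
     in max \<beta>1 \<beta>2)"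

text \<open>Step type 1 (\<open>restart = False\<close>) and step type 2 (\<open>restart = True\<close>).\<close>

definition cg_attempt ::
  "(real^'n \<Rightarrow> real) \<Rightarrow> real \<Rightarrow> real \<Rightarrow> real^'n \<Rightarrow> bool \<Rightarrow> (real^'n) cag_state
    \<Rightarrow> (real^'n) attempt" where
  "cg_attempt f L l x0 restart s0 =
    (let x = xk s0;
         g = grad f x;
         s1 = (if restart \<or> icg s0 \<ge> 6 * CARD('n) + 1
               then s0\<lparr>pk := - g, icg := 0\<rparr> else s0);
         s = s1\<lparr>icg := icg s1 + 1, iag := 0\<rparr>;
         p = pk s;
         xt = x + (1 / L) *\<^sub>R p;
         w = L *\<^sub>R (grad f xt - g)
     in if grad f xt = 0 then Done (Returned xt)
        else if g \<bullet> p \<ge> 0 \<or> p \<bullet> w \<le> 0 then Failed s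
        else
          (let \<alpha> = - (g \<bullet> p) / (p \<bullet> w);
               x1 = x + \<alpha> *\<^sub>R p;
               g1 = grad f x1
           in if g1 = 0 then Done (Returned x1)
              else if f x1 \<le> phi_next f L l s x
              then Done (Running (s\<lparr>xk := x1,
                                    vk := v_next f L l s x,
                                    phik := phi_next f L l s x,
                                    gammak := gamma_next L l (gammak s),
                                    pk := - g1 + beta_next (grad f x0) g g1 p *\<^sub>R p\<rparr>))
              else Failed s))"

definition ag_step ::
  "('a::real_inner \<Rightarrow> real) \<Rightarrow> real \<Rightarrow> real \<Rightarrow> 'a cag_state \<Rightarrow> 'a outcome" where
  "ag_step f L l s0 =
    (let s1 = (if onlyAG s0 then s0 else s0\<lparr>onlyAG := True, iag := 0, icg := 0\<rparr>);
         s = s1\<lparr>iag := iag s1 + 1\<rparr>;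
         \<gamma> = gammak s; \<theta> = theta L l \<gamma>; \<gamma>1 = gamma_next L l \<gamma>;
         xbar = (1 / (\<gamma> + \<theta> * l)) *\<^sub>R ((\<theta> * \<gamma>) *\<^sub>R vk s + \<gamma>1 *\<^sub>R xk s);
         gbar = grad f xbar;
         x1 = xbar - (1 / L) *\<^sub>R gbar;
         g1 = grad f x1;
         t = s\<lparr>xk := x1, vk := v_next f L l s xbar, phik := phi_next f L l s xbar,
               gammak := \<gamma>1\<rparr>
     in if gbar = 0 then Returned xbar
        else if 8 dvd iag s then
          (if g1 = 0 then Returned x1
           else if f x1 \<le> f xbar - 4 / 5 * ((gbar \<bullet> (gbar + g1)) / (2 * L))
           then Running (t\<lparr>pk := - g1, onlyAG := False\<rparr>)
           else Running t)
        else Running t)"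

definition cag_step ::
  "(real^'n \<Rightarrow> real) \<Rightarrow> real \<Rightarrow> real \<Rightarrow> real^'n \<Rightarrow> (real^'n) cag_state
    \<Rightarrow> (real^'n) outcome" where
  "cag_step f L l x0 s =
    (if onlyAG s then ag_step f L l s
     else case cg_attempt f L l x0 False s of
            Done r \<Rightarrow> r
          | Failed s' \<Rightarrow>
              (case cg_attempt f L l x0 True s' of
                 Done r \<Rightarrow> r
               | Failed s'' \<Rightarrow> ag_step f L l s''))"

definition cag_init :: "('a::real_inner \<Rightarrow> real) \<Rightarrow> real \<Rightarrow> 'a \<Rightarrow> 'a cag_state" where
  "cag_init f L x0 =
    \<lparr>xk = x0, vk = x0, phik = f x0, gammak = L, pk = - grad f x0,
     onlyAG = False, icg = 0, iag = 0\<rparr>"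

text \<open>The value is \<^term>\<open>None\<close> at all indices after the one at which a point is returned.\<close>

primrec cag_run ::
  "(real^'n \<Rightarrow> real) \<Rightarrow> real \<Rightarrow> real \<Rightarrow> real^'n \<Rightarrow> nat \<Rightarrow> (real^'n) outcome option" where
  "cag_run f L l x0 0 =
    Some (if grad f x0 = 0 then Returned x0 else Running (cag_init f L x0))"
| "cag_run f L l x0 (Suc k) =
    (case cag_run f L l x0 k of
       Some (Running s) \<Rightarrow> Some (cag_step f L l x0 s)
     | _ \<Rightarrow> None)"

fun outcome_point :: "'a outcome \<Rightarrow> 'a" where
  "outcome_point (Returned x) = x"
| "outcome_point (Running s) = xk s"

definition cag_iterate ::
  "(real^'n \<Rightarrow> real) \<Rightarrow> real \<Rightarrow> real \<Rightarrow> real^'n \<Rightarrow> nat \<Rightarrow> (real^'n) option" where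
  "cag_iterate f L l x0 k = map_option outcome_point (cag_run f L l x0 k)"

end

theory Submission
  imports Defs
begin

text \<open>
  Conjugate gradient keeps a subspace \<open>W\<close> of dimension \<open>k\<close>, the span of the previous search
  directions, to which the current gradient is orthogonal; so the iterate minimizes the quadratic
  over its translate by \<open>W\<close>, and the run stops within \<open>CARD('n)\<close> steps. In C+AG the
  point \<open>v\<close> stays in the same translate, whence the term \<open>g \<bullet> (v - x)\<close> of the update of
  \<open>\<phi>\<close> vanishes. As \<open>\<theta>\<^sup>2 / \<gamma>' = 1 / L\<close> for the new value \<open>\<gamma>'\<close> of \<open>\<gamma>\<close>, the new
  \<open>\<phi>\<close> is at least \<open>f x - (norm g)\<^sup>2 / (2 * L)\<close>, which bounds \<open>f (x - g / L)\<close> and therefore the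
  value at the next conjugate gradient iterate from above. So every step of type 1 is accepted.
  The formula for \<open>\<beta>\<close> reduces to that of linear conjugate gradient by orthogonality, and
  the reset after \<open>6n + 1\<close> steps is never reached.
\<close>

section \<open>Gradients and minimizers of positive definite quadratics\<close>

lemma grad_unique:
  assumes "GDERIV f x :> d"
  shows "grad f x = d"
  unfolding grad_def
proof (rule the_equality)
  fix d' assume "GDERIV f x :> d'"
  then have "(\<lambda>h. h \<bullet> d') = (\<lambda>h. h \<bullet> d)"
    using assms unfolding gderiv_def by (rule has_derivative_unique)
  then show "d' = d"
    by (metis inner_commute vector_eq_ldot)
qed (fact assms)

lemma sym_pos_def_inner:
  assumes "sym_pos_def A"
  shows "x \<bullet> (A *v y) = (A *v x) \<bullet> y"
  using assms by (metis dot_lmul_matrix sym_pos_def_def transpose_matrix_vector)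

lemma sym_pos_def_nonneg: "sym_pos_def A \<Longrightarrow> 0 \<le> x \<bullet> (A *v x)"
  by (cases "x = 0") (auto simp: sym_pos_def_def less_imp_le)

lemma grad_quad:
  assumes "sym_pos_def A"
  shows "grad (quad A b) x = A *v x - b"
proof (rule grad_unique)
  have "(quad A b has_derivative
          (\<lambda>h. 1 / 2 * (x \<bullet> (A *v h) + h \<bullet> (A *v x)) - b \<bullet> h)) (at x)"
    unfolding quad_def
    by (auto intro!: derivative_eq_intros
          has_derivative_compose[OF has_derivative_ident
            bounded_linear.has_derivative[OF matrix_vector_mul_bounded_linear]])
  moreover have "1 / 2 * (x \<bullet> (A *v h) + h \<bullet> (A *v x)) - b \<bullet> h = h \<bullet> (A *v x - b)" for h
    using sym_pos_def_inner[OF assms, of x h] by (simp add: inner_diff_right inner_commute)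
  ultimately show "GDERIV (quad A b) x :> A *v x - b"
    unfolding gderiv_def by simp
qed

lemma grad_quad_add:
  assumes "sym_pos_def A"
  shows "grad (quad A b) (x + c *\<^sub>R d) = grad (quad A b) x + c *\<^sub>R (A *v d)"
  by (simp add: grad_quad[OF assms] matrix_vector_right_distrib matrix_vector_mult_scaleR)

lemma quad_expand:
  assumes "sym_pos_def A"
  shows "quad A b y =
    quad A b x + grad (quad A b) x \<bullet> (y - x) + 1 / 2 * ((y - x) \<bullet> (A *v (y - x)))"
  using sym_pos_def_inner[OF assms, of x y]
  by (simp add: grad_quad[OF assms] quad_def matrix_vector_mult_diff_distrib inner_diff_left
        inner_diff_right inner_commute field_simps)

lemma is_arg_min_quad_iff:
  assumes A: "sym_pos_def A" and "grad (quad A b) x = 0"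
  shows "is_arg_min (quad A b) (\<lambda>_. True) y \<longleftrightarrow> y = x"
proof -
  have eq: "quad A b z = quad A b x + 1 / 2 * ((z - x) \<bullet> (A *v (z - x)))" for z
    using quad_expand[OF A, of b z x] assms(2) by simp
  have le: "quad A b x \<le> quad A b z" for z
    using eq[of z] sym_pos_def_nonneg[OF A, of "z - x"] by simp
  have less: "quad A b x < quad A b z" if "z \<noteq> x" for z
    using eq[of z] A that by (simp add: sym_pos_def_def)
  show ?thesis
    using le less by (metis is_arg_min_def not_less)
qed

section \<open>The scalar recursion of the accelerated gradient parameters\<close>

text \<open>The defining quadratic is \<open>- \<gamma>\<close> at 0 and \<open>L - l\<close> at 1,
  so it has a root in between; the last claim is the equation of that root rearranged.\<close>

lemma theta_works:
  assumes "0 < \<gamma>" "0 < L" "l \<le> L"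
  defines "\<theta> \<equiv> theta L l \<gamma>"
  shows theta_pos: "0 < \<theta>"
    and theta_le_1: "\<theta> \<le> 1"
    and gamma_next_eq: "gamma_next L l \<gamma> = L * \<theta>\<^sup>2"
proof -
  let ?q = "\<lambda>t. L * t\<^sup>2 + (\<gamma> - l) * t - \<gamma>"
  have "\<exists>t\<ge>0. t \<le> 1 \<and> ?q t = 0"
    using assms(1,3) by (intro IVT'[of ?q 0 0 1]) (auto intro!: continuous_intros)
  then obtain t where t: "0 \<le> t" "t \<le> 1" "?q t = 0" by blast
  with assms(1) have t0: "0 < t" by (cases "t = 0") auto
  have "t' = t" if "t' > 0" "?q t' = 0" for t'
  proof (rule ccontr)
    assume ne: "t' \<noteq> t"
    \<comment> \<open>This combination cancels the linear terms and leaves a factor that is positive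
      whenever both roots are.\<close>
    have "(t' - t) * (L * (t' * t) + \<gamma>) = t * ?q t' - t' * ?q t"
      by (simp add: algebra_simps power2_eq_square)
    then have "(t' - t) * (L * (t' * t) + \<gamma>) = 0"
      using t that by simp
    with ne have "L * (t' * t) + \<gamma> = 0" by simp
    moreover have "L * (t' * t) + \<gamma> > 0"
      using assms(1,2) t0 that(1) by (intro add_pos_pos mult_pos_pos)
    ultimately show False by simp
  qed
  then have "\<theta> = t"
    unfolding \<theta>_def theta_def using t(3) t0 by (intro the_equality) blast+
  moreover have "gamma_next L l \<gamma> = \<gamma> - (\<gamma> - l) * \<theta>"
    by (simp add: gamma_next_def \<theta>_def algebra_simps)
  ultimately show "0 < \<theta>" "\<theta> \<le> 1" "gamma_next L l \<gamma> = L * \<theta>\<^sup>2"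
    using t t0 by simp_all
qed

section \<open>One step of linear conjugate gradient\<close>

text \<open>\<open>W\<close> stands for the span of the earlier search directions. Membership of
  \<open>p + grad (quad A b) x\<close> abstracts the rule that \<open>p\<close> is the negative
  gradient plus a multiple of the previous direction. The last clause is the Krylov property:
  \<open>A\<close> leads out of \<open>W\<close> by at most the direction \<open>p\<close>.\<close>

definition cg_invariant ::
  "real^'n^'n \<Rightarrow> real^'n \<Rightarrow> (real^'n) set \<Rightarrow> real^'n \<Rightarrow> real^'n \<Rightarrow> bool" where
  "cg_invariant A b W x p \<longleftrightarrow>
     subspace W \<and> p + grad (quad A b) x \<in> W \<and>
     (\<forall>w\<in>W. grad (quad A b) x \<bullet> w = 0 \<and> p \<bullet> (A *v w) = 0 \<and> A *v w \<in> span (insert p W))"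

lemma cg_invariant_init: "cg_invariant A b {0} x (- grad (quad A b) x)"
  by (simp add: cg_invariant_def subspace_single_0 span_0)

locale conjugate_gradient =
  fixes A :: "real^'n^'n" and b x p :: "real^'n" and W :: "(real^'n) set"
  assumes A: "sym_pos_def A"
    and invariant: "cg_invariant A b W x p"
    and grad_nonzero: "grad (quad A b) x \<noteq> 0"
begin

definition g where "g = grad (quad A b) x"
definition \<alpha> where "\<alpha> = - (g \<bullet> p) / (p \<bullet> (A *v p))"
definition x1 where "x1 = x + \<alpha> *\<^sub>R p"
definition g1 where "g1 = grad (quad A b) x1"
definition p1 where "p1 = - g1 + ((norm g1)\<^sup>2 / (norm g)\<^sup>2) *\<^sub>R p"
definition W1 where "W1 = span (insert p W)"

lemma cg_step_eq: "cg_step A b (x, p) = (x1, p1)"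
  by (simp add: cg_step_def Let_def x1_def \<alpha>_def g_def p1_def g1_def)

lemma subspace: "subspace W"
  and p_plus_g: "p + g \<in> W"
  and g_orth: "w \<in> W \<Longrightarrow> g \<bullet> w = 0"
  and p_conj: "w \<in> W \<Longrightarrow> p \<bullet> (A *v w) = 0"
  and A_mem_W1: "w \<in> W \<Longrightarrow> A *v w \<in> W1"
  using invariant by (auto simp: cg_invariant_def g_def W1_def)

lemma g_nonzero: "g \<noteq> 0"
  using grad_nonzero by (simp add: g_def)

lemma g_inner_p: "g \<bullet> p = - (norm g)\<^sup>2"
  using g_orth[OF p_plus_g] by (simp add: inner_add_right power2_norm_eq_inner)

lemma p_nonzero: "p \<noteq> 0"
  using g_inner_p g_nonzero by auto

lemma curvature_pos: "0 < p \<bullet> (A *v p)"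
  using A p_nonzero by (simp add: sym_pos_def_def)

lemma \<alpha>_pos: "0 < \<alpha>"
  using g_inner_p g_nonzero curvature_pos by (simp add: \<alpha>_def)

lemma subspace_W1: "subspace W1"
  by (simp add: W1_def subspace_span)

lemma W_subset_W1: "W \<subseteq> W1"
  unfolding W1_def by (meson span_superset subset_insertI subset_trans)

lemma p_mem_W1: "p \<in> W1"
  by (simp add: W1_def span_base)

lemma g_mem_W1: "g \<in> W1"
  using subspace_diff[OF subspace_W1 _ p_mem_W1, of "p + g"] p_plus_g W_subset_W1 by auto

lemma g1_eq: "g1 = g + \<alpha> *\<^sub>R (A *v p)"
  by (simp add: g1_def g_def x1_def grad_quad_add[OF A])

lemma A_p_eq: "A *v p = (1 / \<alpha>) *\<^sub>R (g1 - g)"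
  using \<alpha>_pos by (simp add: g1_eq)

text \<open>On \<open>p\<close> this is the exact line search encoded in \<open>\<alpha>\<close>; on
  \<open>W\<close> it is inherited from \<open>g\<close>, because \<open>p\<close> is conjugate to
  \<open>W\<close>.\<close>

lemma g1_orth:
  assumes "w \<in> W1"
  shows "g1 \<bullet> w = 0"
  using assms unfolding W1_def
proof (induction rule: span_induct)
  case base
  show ?case by (rule subspace_hyperplane)
next
  case (step u)
  show ?case
  proof (cases "u = p")
    case True
    then show ?thesis
      using curvature_pos by (simp add: g1_eq inner_add_left inner_diff_left \<alpha>_def inner_commute[of "A *v p"])
  next
    case False
    with step have "u \<in> W" by simp
    then show ?thesis
      using g_orth p_conj sym_pos_def_inner[OF A, of p u] by (simp add: g1_eq inner_add_left)
  qed
qed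

text \<open>Against \<open>p\<close>, the vector \<open>A *v p\<close> is a multiple of
  \<open>g1 - g\<close>, and the coefficient of \<open>p\<close> in \<open>p1\<close> makes the two
  contributions cancel. Against \<open>W\<close>, the Krylov property puts \<open>A *v w\<close>
  into \<open>W1\<close>, to which \<open>g1\<close> is orthogonal.\<close>

lemma p1_conj:
  assumes "w \<in> W1"
  shows "p1 \<bullet> (A *v w) = 0"
  using assms unfolding W1_def
proof (induction rule: span_induct)
  case base
  have "{w. p1 \<bullet> (A *v w) = 0} = {w. (A *v p1) \<bullet> w = 0}"
    by (simp add: sym_pos_def_inner[OF A])
  then show ?case by (metis subspace_hyperplane)
next
  case (step u)
  show ?case
  proof (cases "u = p")
    case True
    have "g1 \<bullet> (A *v p) = (norm g1)\<^sup>2 / \<alpha>"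
      using g1_orth[OF g_mem_W1] by (simp add: A_p_eq inner_diff_right power2_norm_eq_inner)
    moreover have "p \<bullet> (A *v p) = (norm g)\<^sup>2 / \<alpha>"
      using g1_orth[OF p_mem_W1] g_inner_p
      by (simp add: A_p_eq inner_diff_right inner_commute)
    ultimately show ?thesis
      using True g_nonzero by (simp add: p1_def inner_diff_left inner_add_left)
  next
    case False
    with step have "u \<in> W" by simp
    then show ?thesis
      using g1_orth[OF A_mem_W1] p_conj by (simp add: p1_def inner_diff_left inner_add_left)
  qed
qed

text \<open>Only \<open>A *v p\<close> is new. It is a multiple of \<open>g1 - g\<close>, and
  \<open>g1\<close> is recovered from \<open>p1\<close> and \<open>p\<close>.\<close>

lemma A_mem_next:
  assumes "w \<in> W1"
  shows "A *v w \<in> span (insert p1 W1)"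
proof -
  have sub: "W1 \<subseteq> span (insert p1 W1)" and p1: "p1 \<in> span (insert p1 W1)"
    by (auto intro: span_base)
  have "g1 = ((norm g1)\<^sup>2 / (norm g)\<^sup>2) *\<^sub>R p - p1" by (simp add: p1_def)
  then have g1: "g1 \<in> span (insert p1 W1)"
    using sub p1 p_mem_W1 by (metis span_diff span_scale subsetD)
  show ?thesis
    using assms unfolding W1_def
  proof (induction rule: span_induct)
    case base
    show ?case
      unfolding W1_def[symmetric]
      using linear_subspace_vimage[OF matrix_vector_mul_linear subspace_span, of A]
      by (simp add: vimage_def)
  next
    case (step u)
    then show ?case
      unfolding W1_def[symmetric]
      using A_mem_W1 sub g1 g_mem_W1 by (auto simp: A_p_eq intro!: span_scale span_diff)
  qed
qed

lemma cg_invariant_next: "cg_invariant A b W1 x1 p1"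
proof -
  have "p1 + g1 = ((norm g1)\<^sup>2 / (norm g)\<^sup>2) *\<^sub>R p" by (simp add: p1_def)
  then have "p1 + g1 \<in> W1"
    using p_mem_W1 subspace_W1 by (simp add: subspace_scale)
  then show ?thesis
    unfolding cg_invariant_def g1_def[symmetric]
    using subspace_W1 g1_orth p1_conj A_mem_next by blast
qed

text \<open>The gradient \<open>g\<close> is orthogonal to \<open>W\<close> but not to
  \<open>p\<close>. This growth is what forces finite termination.\<close>

lemma dim_W1: "dim W1 = dim W + 1"
proof -
  have "p \<notin> span W"
    using g_orth[of p] g_inner_p g_nonzero subspace by (auto simp: span_eq_iff[THEN iffD2])
  then show ?thesis by (simp add: W1_def dim_insert)
qed

lemma quad_x1_le:
  assumes "y - x \<in> W1"
  shows "quad A b x1 \<le> quad A b y"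
proof -
  have eq: "y - x1 = (y - x) - \<alpha> *\<^sub>R p" by (simp add: x1_def)
  have "y - x1 \<in> W1"
    unfolding eq using assms p_mem_W1 subspace_W1 by (meson subspace_diff subspace_scale)
  then show ?thesis
    using quad_expand[OF A, of b y x1] g1_orth sym_pos_def_nonneg[OF A, of "y - x1"]
    by (simp add: g1_def)
qed

text \<open>C+AG also stops when the gradient vanishes at its trial point, which lies in the
  translate of \<open>W1\<close>; this identifies that point with the next conjugate gradient
  iterate.\<close>

lemma critical_point_eq_x1:
  assumes "y - x \<in> W1" "grad (quad A b) y = 0"
  shows "y = x1"
proof -
  have "is_arg_min (quad A b) (\<lambda>_. True) x1"
    using quad_x1_le[OF assms(1)] is_arg_min_quad_iff[OF A assms(2), of y]
    by (auto simp: is_arg_min_def not_less intro: order_trans)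
  then show ?thesis
    using is_arg_min_quad_iff[OF A assms(2)] by simp
qed

text \<open>Orthogonality of \<open>g1\<close> to \<open>p\<close> and \<open>g\<close> turns the
  first candidate into the Fletcher-Reeves quotient, which is nonnegative and hence wins against the
  second one.\<close>

lemma beta_next_eq: "beta_next g0 g g1 p = (norm g1)\<^sup>2 / (norm g)\<^sup>2"
proof -
  have 1: "(g1 - g) \<bullet> p = (norm g)\<^sup>2"
    using g1_orth[OF p_mem_W1] g_inner_p by (simp add: inner_diff_left)
  have 2: "(g1 - g) \<bullet> g1 = (norm g1)\<^sup>2"
    using g1_orth[OF g_mem_W1] by (simp add: inner_diff_left inner_commute[of g] power2_norm_eq_inner)
  have 3: "p \<bullet> g1 = 0"
    using g1_orth[OF p_mem_W1] by (simp add: inner_commute)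
  \<comment> \<open>A zero denominator is harmless: the quotient is then 0.\<close>
  have "- 1 / (norm p * min (1 / 100 * norm g0) (norm g1)) \<le> 0"
    by simp
  also have "0 \<le> (norm g1)\<^sup>2 / (norm g)\<^sup>2" by simp
  finally show ?thesis
    unfolding beta_next_def Let_def 1
    by (simp add: inner_diff_left[of "g1 - g"] 2 3 max_def)
qed

end

section \<open>C+AG steps as conjugate gradient steps\<close>

text \<open>The clause on \<open>dim W\<close> bounds the counter \<open>icg\<close>, which excludes the periodic reset.\<close>

definition cag_invariant ::
  "real^'n^'n \<Rightarrow> real^'n \<Rightarrow> (real^'n) set \<Rightarrow> (real^'n) cag_state \<Rightarrow> bool" where
  "cag_invariant A b W s \<longleftrightarrow>
     cg_invariant A b W (xk s) (pk s) \<and> grad (quad A b) (xk s) \<noteq> 0 \<and>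
     vk s - xk s \<in> W \<and> quad A b (xk s) \<le> phik s \<and> 0 < gammak s \<and>
     \<not> onlyAG s \<and> icg s = dim W"

locale cag_cg = conjugate_gradient A b "xk s" "pk s" W
  for A :: "real^'n^'n" and b :: "real^'n" and s :: "(real^'n) cag_state" and W +
  fixes L l :: real
  assumes state: "cag_invariant A b W s"
    and L_pos: "0 < L" and l_nonneg: "0 \<le> l" and l_le_L: "l \<le> L"
    and smooth: "smooth_convex L (quad A b)"
begin

abbreviation \<theta> where "\<theta> \<equiv> theta L l (gammak s)"

lemma gammak_pos: "0 < gammak s"
  using state by (simp add: cag_invariant_def)

lemmas \<theta>_pos = theta_pos[OF gammak_pos L_pos l_le_L]
lemmas \<theta>_le_1 = theta_le_1[OF gammak_pos L_pos l_le_L]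
lemmas gamma_next_\<theta> = gamma_next_eq[OF gammak_pos L_pos l_le_L]

lemma gamma_next_pos: "0 < gamma_next L l (gammak s)"
  using \<theta>_pos L_pos by (simp add: gamma_next_\<theta>)

text \<open>This is the acceptance test. The comparison point \<open>x - g / L\<close> lies in the
  translate over which \<open>x1\<close> minimizes, and smoothness gives it exactly the decrease
  that \<open>phi_next\<close> subtracts.\<close>

lemma quad_x1_le_phi_next: "quad A b x1 \<le> phi_next (quad A b) L l s (xk s)"
proof -
  let ?f = "quad A b"
  have st: "vk s - xk s \<in> W" "?f (xk s) \<le> phik s"
    using state by (auto simp: cag_invariant_def)
  have "?f x1 \<le> ?f (xk s - (1 / L) *\<^sub>R g)"
    using g_mem_W1 subspace_W1 by (intro quad_x1_le) (simp add: subspace_neg subspace_scale)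
  also have "\<dots> \<le> ?f (xk s) + g \<bullet> (- (1 / L) *\<^sub>R g) + L / 2 * (norm ((1 / L) *\<^sub>R g))\<^sup>2"
  proof -
    have "?f y - ?f (xk s) - g \<bullet> (y - xk s) \<le> L / 2 * (norm (xk s - y))\<^sup>2" for y
      using smooth by (simp add: smooth_convex_def g_def)
    from this[of "xk s - (1 / L) *\<^sub>R g"] show ?thesis by simp
  qed
  also have "\<dots> = ?f (xk s) - 1 / (2 * L) * (norm g)\<^sup>2"
    using L_pos by (simp add: power_mult_distrib power2_norm_eq_inner[symmetric] field_simps power2_eq_square[of L])
  also have "\<dots> \<le> phi_next ?f L l s (xk s)"
  proof -
    have "\<theta>\<^sup>2 / (2 * gamma_next L l (gammak s)) = 1 / (2 * L)"
      using \<theta>_pos by (simp add: gamma_next_\<theta>)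
    moreover have "(1 - \<theta>) * ?f (xk s) \<le> (1 - \<theta>) * phik s"
      using st(2) \<theta>_le_1 by (simp add: mult_left_mono)
    moreover have "0 \<le> \<theta> * (1 - \<theta>) * gammak s / gamma_next L l (gammak s) *
        (l / 2 * (norm (xk s - vk s))\<^sup>2 + g \<bullet> (vk s - xk s))"
      using g_orth[OF st(1)] \<theta>_pos \<theta>_le_1 gamma_next_pos gammak_pos l_nonneg by simp
    moreover have "phi_next ?f L l s (xk s) =
        (1 - \<theta>) * phik s + \<theta> * ?f (xk s) - \<theta>\<^sup>2 / (2 * gamma_next L l (gammak s)) * (norm g)\<^sup>2 +
        \<theta> * (1 - \<theta>) * gammak s / gamma_next L l (gammak s) *
        (l / 2 * (norm (xk s - vk s))\<^sup>2 + g \<bullet> (vk s - xk s))"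
      by (simp add: phi_next_def Let_def g_def)
    moreover have "(1 - \<theta>) * ?f (xk s) = ?f (xk s) - \<theta> * ?f (xk s)"
      by (simp add: algebra_simps)
    ultimately show ?thesis by simp
  qed
  finally show ?thesis .
qed

lemma v_next_diff_mem: "v_next (quad A b) L l s (xk s) - x1 \<in> W1"
proof -
  let ?\<gamma>1 = "gamma_next L l (gammak s)"
  let ?u = "((1 - \<theta>) * gammak s) *\<^sub>R (vk s - xk s) - \<theta> *\<^sub>R g"
  \<comment> \<open>The coefficients of \<open>vk s\<close> and \<open>xk s\<close> in the original
    sum add up to \<open>gamma_next\<close>, so after division \<open>xk s\<close> splits off with
    weight 1.\<close>
  have "((1 - \<theta>) * gammak s) *\<^sub>R vk s + (\<theta> * l) *\<^sub>R xk s - \<theta> *\<^sub>R g = ?u + ?\<gamma>1 *\<^sub>R xk s"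
    by (simp add: gamma_next_def algebra_simps)
  then have "v_next (quad A b) L l s (xk s) = (1 / ?\<gamma>1) *\<^sub>R (?u + ?\<gamma>1 *\<^sub>R xk s)"
    by (simp add: v_next_def Let_def g_def)
  then have eq: "v_next (quad A b) L l s (xk s) - x1 = (1 / ?\<gamma>1) *\<^sub>R ?u - \<alpha> *\<^sub>R pk s"
    using gamma_next_pos by (simp add: x1_def scaleR_add_right)
  have "vk s - xk s \<in> W1"
    using state W_subset_W1 by (auto simp: cag_invariant_def)
  then show ?thesis
    unfolding eq using g_mem_W1 p_mem_W1 subspace_W1
    by (meson subspace_diff subspace_scale)
qed

text \<open>Type 1 never fails: descent and curvature hold for the conjugate gradient direction, and
  the value test is \<open>quad_x1_le_phi_next\<close>. Both early exits, at the trial point and at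
  the next iterate, return \<open>x1\<close>.\<close>

lemma cag_step_cases:
  obtains "cag_step (quad A b) L l x0 s = Returned x1" "g1 = 0"
  | s' where "cag_step (quad A b) L l x0 s = Running s'" "cag_invariant A b W1 s'"
      "xk s' = x1" "pk s' = p1"
proof -
  let ?f = "quad A b"
  define xt where "xt = xk s + (1 / L) *\<^sub>R pk s"
  have "dim W \<le> CARD('n)"
    using dim_subset_UNIV[of W] by simp
  then have icg: "\<not> 6 * CARD('n) + 1 \<le> icg s"
    using state by (simp add: cag_invariant_def)
  \<comment> \<open>The gradient is affine, so the finite difference is exact and yields the step
    length of linear conjugate gradient.\<close>
  have w: "L *\<^sub>R (grad ?f xt - grad ?f (xk s)) = A *v pk s"
    using L_pos by (simp add: xt_def grad_quad_add[OF A])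
  have gp: "grad ?f (xk s) \<bullet> pk s < 0"
    using g_inner_p g_nonzero by (simp add: g_def)
  have xt: "grad ?f xt = 0 \<Longrightarrow> xt = x1"
    using p_mem_W1 subspace_W1
    by (intro critical_point_eq_x1) (simp_all add: xt_def subspace_scale)
  \<comment> \<open>Only the counters differ from \<open>s\<close>, and the updates of
    \<open>v\<close> and \<open>\<phi>\<close> do not see them.\<close>
  define s1 where "s1 = s\<lparr>icg := icg s + 1, iag := 0\<rparr>"
  have phi: "phi_next ?f L l s1 y = phi_next ?f L l s y"
    and v: "v_next ?f L l s1 y = v_next ?f L l s y" for y
    by (simp_all add: s1_def phi_next_def v_next_def)
  have attempt: "cg_attempt ?f L l x0 False s =
    (if grad ?f xt = 0 \<or> g1 = 0 then Done (Returned x1)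
     else Done (Running (s1\<lparr>xk := x1, vk := v_next ?f L l s (xk s),
       phik := phi_next ?f L l s (xk s), gammak := gamma_next L l (gammak s), pk := p1\<rparr>)))"
  proof -
    have "cg_attempt ?f L l x0 False s =
     (if grad ?f xt = 0 then Done (Returned xt)
      else if g1 = 0 then Done (Returned x1)
      else if ?f x1 \<le> phi_next ?f L l s (xk s)
      then Done (Running (s1\<lparr>xk := x1, vk := v_next ?f L l s (xk s),
             phik := phi_next ?f L l s (xk s), gammak := gamma_next L l (gammak s),
             pk := - g1 + beta_next (grad ?f x0) g g1 (pk s) *\<^sub>R pk s\<rparr>))
      else Failed s1)"
    proof -
      have s: "(if False \<or> 6 * CARD('n) + 1 \<le> icg s then s\<lparr>pk := - grad ?f (xk s), icg := 0\<rparr> else s)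
          = s"
        using icg by simp
      have s1: "pk s1 = pk s" "gammak s1 = gammak s"
        by (simp_all add: s1_def)
      have \<alpha>: "- (grad ?f (xk s) \<bullet> pk s) / (pk s \<bullet> (A *v pk s)) = \<alpha>"
        by (simp add: \<alpha>_def g_def)
      show ?thesis
        unfolding cg_attempt_def Let_def s
        unfolding s1_def[symmetric] s1 phi v
        unfolding xt_def[symmetric]
        unfolding w \<alpha>
        unfolding x1_def[symmetric]
        unfolding g1_def[symmetric] g_def[symmetric]
        using gp curvature_pos by (simp add: g_def)
    qed
    then show ?thesis
      using xt quad_x1_le_phi_next by (simp add: beta_next_eq p1_def)
  qed
  have step: "cag_step ?f L l x0 s = r" if "cg_attempt ?f L l x0 False s = Done r" for r
    using state that by (simp add: cag_step_def cag_invariant_def)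
  show thesis
  proof (cases "grad ?f xt = 0 \<or> g1 = 0")
    case True
    \<comment> \<open>A critical trial point coincides with \<open>x1\<close>, so \<open>g1\<close>
      vanishes in either case.\<close>
    with xt have "g1 = 0" by (auto simp: g1_def)
    with True show thesis using that(1) step attempt by simp
  next
    case False
    define s' where "s' = s1\<lparr>xk := x1, vk := v_next ?f L l s (xk s),
       phik := phi_next ?f L l s (xk s), gammak := gamma_next L l (gammak s), pk := p1\<rparr>"
    have "cag_invariant A b W1 s'"
      using cg_invariant_next False v_next_diff_mem quad_x1_le_phi_next gamma_next_pos dim_W1 state
      by (simp add: cag_invariant_def s'_def s1_def g1_def)
    then show thesis
      using that(2)[of s'] step attempt False by (simp add: s'_def)
  qed
qed

end

section \<open>Correspondence of the two runs and termination\<close>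

text \<open>The alternatives are the phases of a run: active, just stopped, and over. The first
  records \<open>dim W = k\<close> so that it cannot last; the third remembers a return so that
  termination can be read off at any late index.\<close>

lemma runs_correspond:
  fixes A :: "real^'n^'n"
  assumes A: "sym_pos_def A" and L: "0 < L" and l: "0 \<le> l" "l \<le> L"
    and smooth: "smooth_convex L (quad A b)"
  defines "f \<equiv> quad A b"
  shows "(\<exists>W s. cag_run f L l x0 k = Some (Running s) \<and> cg_run A b x0 k = Some (xk s, pk s) \<and>
            cag_invariant A b W s \<and> dim W = k)
    \<or> (\<exists>x p. cag_run f L l x0 k = Some (Returned x) \<and> cg_run A b x0 k = Some (x, p) \<and>
            grad f x = 0)
    \<or> (cag_run f L l x0 k = None \<and> cg_run A b x0 k = None \<and>
        (\<exists>j x. cag_run f L l x0 j = Some (Returned x) \<and> grad f x = 0))"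
proof (induction k)
  case 0
  show ?case
  proof (cases "grad f x0 = 0")
    case True
    then show ?thesis by (simp add: f_def)
  next
    case False
    then have "cag_invariant A b {0} (cag_init f L x0)"
      using L cg_invariant_init[of A b x0]
      by (simp add: cag_invariant_def cag_init_def f_def)
    with False show ?thesis
      by (intro disjI1 exI[of _ "{0}"]) (simp add: f_def cag_init_def)
  qed
next
  case (Suc k)
  then consider W s where "cag_run f L l x0 k = Some (Running s)"
      "cg_run A b x0 k = Some (xk s, pk s)" "cag_invariant A b W s" "dim W = k"
    | x p where "cag_run f L l x0 k = Some (Returned x)" "cg_run A b x0 k = Some (x, p)"
      "grad f x = 0"
    | "cag_run f L l x0 k = None" "cg_run A b x0 k = None"
      "\<exists>j x. cag_run f L l x0 j = Some (Returned x) \<and> grad f x = 0"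
    by (elim disjE exE conjE) auto
  then show ?case
  proof cases
    case (1 W s)
    interpret cag_cg A b s W L l
      using A L l smooth 1(3) by unfold_locales (auto simp: cag_invariant_def)
    have cg: "cg_run A b x0 (Suc k) = Some (x1, p1)"
      using 1(2) grad_nonzero cg_step_eq by simp
    have cag: "cag_run f L l x0 (Suc k) = Some (cag_step f L l x0 s)"
      using 1(1) by simp
    show ?thesis
    proof (rule cag_step_cases[of x0])
      assume "cag_step (quad A b) L l x0 s = Returned x1" "g1 = 0"
      then show ?thesis
        using cg cag by (simp add: f_def g1_def)
    next
      fix s' assume "cag_step (quad A b) L l x0 s = Running s'" "cag_invariant A b W1 s'"
        "xk s' = x1" "pk s' = p1"
      then show ?thesis
        using cg cag dim_W1 1(4) unfolding f_def
        by (intro disjI1 exI[of _ W1] exI[of _ s']) simp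
    qed
  next
    case (2 x p)
    then show ?thesis by (auto simp: f_def)
  next
    case 3
    then show ?thesis by simp
  qed
qed

text \<open>Both bounds are compared between 0 and a unit vector. The result is what keeps
  \<open>theta\<close> at most 1.\<close>

lemma strong_convexity_le_smoothness:
  fixes f :: "'a::euclidean_space \<Rightarrow> real"
  assumes "smooth_convex L f" "strongly_convex l f"
  shows "l \<le> L"
proof -
  obtain e :: 'a where "norm e = 1"
    using vector_choose_size[of 1] by auto
  moreover have "l / 2 * (norm (0 - e))\<^sup>2 \<le> f e - f 0 - grad f 0 \<bullet> (e - 0)"
    using assms(2) unfolding strongly_convex_def by blast
  moreover have "f e - f 0 - grad f 0 \<bullet> (e - 0) \<le> L / 2 * (norm (0 - e))\<^sup>2"
    using assms(1) unfolding smooth_convex_def by blast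
  ultimately show ?thesis by simp
qed

theorem mainTheorem3:
  fixes A :: "real^'n^'n" and b x0 :: "real^'n" and L l :: real
  assumes "sym_pos_def A"
    and "L > 0" and "l \<ge> 0"
    and "smooth_convex L (quad A b)"
    and "strongly_convex l (quad A b)"
  shows "(\<forall>k. cag_iterate (quad A b) L l x0 k = cg_iterate A b x0 k) \<and>
    (\<exists>K x. cag_run (quad A b) L l x0 K = Some (Returned x) \<and>
           (\<forall>y. is_arg_min (quad A b) (\<lambda>_. True) y \<longleftrightarrow> y = x))"
proof (intro conjI allI)
  note runs = runs_correspond[OF assms(1-3) strong_convexity_le_smoothness[OF assms(4,5)] assms(4)]
  show "cag_iterate (quad A b) L l x0 k = cg_iterate A b x0 k" for k
    using runs[of x0 k] by (auto simp: cag_iterate_def cg_iterate_def)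
  \<comment> \<open>At this index the dimension alone rules out the active phase, and each remaining
    alternative supplies a returned critical point.\<close>
  have "dim W \<noteq> Suc CARD('n)" for W :: "(real^'n) set"
    using dim_subset_UNIV[of W] by simp
  then obtain K x where "cag_run (quad A b) L l x0 K = Some (Returned x)" "grad (quad A b) x = 0"
    using runs[of x0 "Suc CARD('n)"] by blast
  then show "\<exists>K x. cag_run (quad A b) L l x0 K = Some (Returned x) \<and>
           (\<forall>y. is_arg_min (quad A b) (\<lambda>_. True) y \<longleftrightarrow> y = x)"
    using is_arg_min_quad_iff[OF assms(1)] by blast
qed

end
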